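(* Let $n\ge 2$ and let $M=\{x_0,x_1,\ldots,x_n\}$ be a subset, consisting of $n+1$ points, of an $\mathbb R$-tree, with distinguished point $x_0=0$. Suppose that $$0<\mathrm{sep}(M):=\tfrac12\inf\{d(x,y)+d(x,z)-d(y,z): x,y,z\in M \text{ distinct}\}.$$ Then $$d_{BM}(\mathcal F(M),\ell_1^n)>\left(1-\frac{\mathrm{sep}(M)}{4\,\mathrm{diam}(M)}\right)^{-1}.$$
   Context: An $\mathbb R$-tree is a geodesic metric space $(T,d)$ satisfying the 4-point condition: $d(a,b)+d(c,e)\le\max\{d(a,c)+d(b,e),\,d(b,c)+d(a,e)\}$ for all $a,b,c,e\in T$. All Banach spaces are real. For a metric space $(M,d)$ with a distinguished point $0\in M$, $\mathrm{Lip}_0(M)$ is the Banach space of Lipschitz functions $f:M\to\mathbb R$ with $f(0)=0$, with norm $\|f\|_L=\sup\{\frac{f(x)-f(y)}{d(x,y)}:x\neq y\}$. The Lipschitz-free space $\mathcal F(M)$ is the norm-closed linear span of $\{\delta_x:x\in M\}$ in $\mathrm{Lip}_0(M)^*$, where $\delta_x(f)=f(x)$. $\mathrm{diam}(M)$ is the diameter of $M$, $\ell_1^n$ is $\mathbb R^n$ with the $\ell_1$-norm, and $d_{BM}(X,Y)=\inf\{\|T\|\,\|T^{-1}\|: T:X\to Y \text{ a linear isomorphism}\}$ is the (multiplicative) Banach-Mazur distance. *)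

theory Defs
  imports "HOL-Analysis.Analysis" "HOL-Library.Function_Algebras"
begin

text \<open>
  The spaces below depend on a subset of a metric space (or on a number \<open>n\<close>), so they cannot be
  types. A normed space is given by a linear subspace \<open>V\<close> of an ambient type of class
  \<^class>\<open>real_vector\<close> together with a norm \<open>nV\<close> that is only meaningful on \<open>V\<close>. The ambient types
  are function types with pointwise operations; elements of the subspaces vanish outside
  their intended domain.
\<close>

instantiation "fun" :: (type, real_vector) real_vector
begin

definition "scaleR c f = (\<lambda>x. c *\<^sub>R f x)"

instance
  by standard (simp_all add: scaleR_fun_def fun_eq_iff scaleR_add_right scaleR_add_left)

end

subsection \<open>Bounded operators and the Banach-Mazur distance\<close>

definition linear_on :: "'v::real_vector set \<Rightarrow> ('v \<Rightarrow> 'w::real_vector) \<Rightarrow> bool" where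
  "linear_on V T \<longleftrightarrow>
     (\<forall>u\<in>V. \<forall>v\<in>V. T (u + v) = T u + T v) \<and> (\<forall>c. \<forall>v\<in>V. T (c *\<^sub>R v) = c *\<^sub>R T v)"

definition bounded_op_on :: "'v set \<Rightarrow> ('v \<Rightarrow> real) \<Rightarrow> ('w \<Rightarrow> real) \<Rightarrow> ('v \<Rightarrow> 'w) \<Rightarrow> bool" where
  "bounded_op_on V nV nW T \<longleftrightarrow> (\<exists>C. \<forall>v\<in>V. nW (T v) \<le> C * nV v)"

definition op_norm_on :: "'v set \<Rightarrow> ('v \<Rightarrow> real) \<Rightarrow> ('w \<Rightarrow> real) \<Rightarrow> ('v \<Rightarrow> 'w) \<Rightarrow> real" where
  "op_norm_on V nV nW T = Sup {nW (T v) | v. v \<in> V \<and> nV v \<le> 1}"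

text \<open>Isomorphisms of normed spaces: the inverse is required to be bounded as well.\<close>

definition linear_iso ::
  "'v::real_vector set \<Rightarrow> ('v \<Rightarrow> real) \<Rightarrow> 'w::real_vector set \<Rightarrow> ('w \<Rightarrow> real) \<Rightarrow> ('v \<Rightarrow> 'w) \<Rightarrow> bool"
  where
  "linear_iso V nV W nW T \<longleftrightarrow>
     bij_betw T V W \<and> linear_on V T \<and>
     bounded_op_on V nV nW T \<and> bounded_op_on W nW nV (inv_into V T)"

text \<open>Extended reals, so that the distance of non-isomorphic spaces is \<open>\<infinity>\<close>.\<close>

definition banach_mazur ::
  "'v::real_vector set \<Rightarrow> ('v \<Rightarrow> real) \<Rightarrow> 'w::real_vector set \<Rightarrow> ('w \<Rightarrow> real) \<Rightarrow> ereal"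
  where
  "banach_mazur V nV W nW =
     Inf {ereal (op_norm_on V nV nW T * op_norm_on W nW nV (inv_into V T)) | T.
            linear_iso V nV W nW T}"

definition dual_space :: "'v::real_vector set \<Rightarrow> ('v \<Rightarrow> real) \<Rightarrow> ('v \<Rightarrow> real) set" where
  "dual_space V nV =
     {\<phi>. linear_on V \<phi> \<and> bounded_op_on V nV abs \<phi> \<and> (\<forall>v. v \<notin> V \<longrightarrow> \<phi> v = 0)}"

definition dual_norm :: "'v set \<Rightarrow> ('v \<Rightarrow> real) \<Rightarrow> ('v \<Rightarrow> real) \<Rightarrow> real" where
  "dual_norm V nV \<phi> = op_norm_on V nV abs \<phi>"

subsection \<open>Lipschitz-free spaces\<close>

text \<open>
  \<open>M\<close> is the metric space and \<open>z\<close> its distinguished point. The Lipschitz norm is the supremum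
  of a nonempty set only if \<open>M\<close> has at least two points.
\<close>

definition Lip0 :: "'a::metric_space set \<Rightarrow> 'a \<Rightarrow> ('a \<Rightarrow> real) set" where
  "Lip0 M z = {f. (\<exists>L. L-lipschitz_on M f) \<and> f z = 0 \<and> (\<forall>x. x \<notin> M \<longrightarrow> f x = 0)}"

definition Lip_norm :: "'a::metric_space set \<Rightarrow> ('a \<Rightarrow> real) \<Rightarrow> real" where
  "Lip_norm M f = Sup {(f x - f y) / dist x y | x y. x \<in> M \<and> y \<in> M \<and> x \<noteq> y}"

definition eval_at :: "'a::metric_space set \<Rightarrow> 'a \<Rightarrow> 'a \<Rightarrow> ('a \<Rightarrow> real) \<Rightarrow> real" where
  "eval_at M z x = (\<lambda>f. if f \<in> Lip0 M z then f x else 0)"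

definition free_norm :: "'a::metric_space set \<Rightarrow> 'a \<Rightarrow> (('a \<Rightarrow> real) \<Rightarrow> real) \<Rightarrow> real" where
  "free_norm M z = dual_norm (Lip0 M z) (Lip_norm M)"

text \<open>The norm closure, inside the dual of \<^const>\<open>Lip0\<close>, of the span of the evaluations.\<close>

definition free_space :: "'a::metric_space set \<Rightarrow> 'a \<Rightarrow> (('a \<Rightarrow> real) \<Rightarrow> real) set" where
  "free_space M z =
     {\<phi> \<in> dual_space (Lip0 M z) (Lip_norm M).
        \<forall>e>0. \<exists>\<psi>\<in>span (eval_at M z ` M). free_norm M z (\<phi> - \<psi>) < e}"

subsection \<open>The space \<open>\<real>\<^sup>n\<close> with the 1-norm\<close>

definition l1_space :: "nat \<Rightarrow> (nat \<Rightarrow> real) set" where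
  "l1_space n = {v. \<forall>i\<ge>n. v i = 0}"

definition l1_norm :: "nat \<Rightarrow> (nat \<Rightarrow> real) \<Rightarrow> real" where
  "l1_norm n v = (\<Sum>i<n. \<bar>v i\<bar>)"

subsection \<open>Real trees and separation\<close>

definition geodesic_set :: "'a::metric_space set \<Rightarrow> bool" where
  "geodesic_set T \<longleftrightarrow>
     (\<forall>a\<in>T. \<forall>b\<in>T. \<exists>\<gamma>::real \<Rightarrow> 'a.
        \<gamma> 0 = a \<and> \<gamma> (dist a b) = b \<and> \<gamma> ` {0..dist a b} \<subseteq> T \<and>
        (\<forall>s\<in>{0..dist a b}. \<forall>t\<in>{0..dist a b}. dist (\<gamma> s) (\<gamma> t) = \<bar>s - t\<bar>))"

definition real_tree :: "'a::metric_space set \<Rightarrow> bool" where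
  "real_tree T \<longleftrightarrow>
     geodesic_set T \<and>
     (\<forall>a\<in>T. \<forall>b\<in>T. \<forall>c\<in>T. \<forall>e\<in>T.
        dist a b + dist c e \<le> max (dist a c + dist b e) (dist b c + dist a e))"

definition sep :: "'a::metric_space set \<Rightarrow> real" where
  "sep M = 1/2 * Inf {dist x y + dist x z - dist y z | x y z.
                        x \<in> M \<and> y \<in> M \<and> z \<in> M \<and> x \<noteq> y \<and> x \<noteq> z \<and> y \<noteq> z}"

end

theory Submission
  imports Defs
begin

text \<open>
  For distinct \<open>a, b \<in> M\<close> the function \<open>w \<mapsto> (d(w,b) - d(w,a)) / 2\<close>, which reads off the
  projection onto the segment from \<open>a\<close> to \<open>b\<close>, has slope of modulus 1 on the pair \<open>a, b\<close>, and
  by the 4-point condition slope of modulus at most \<open>1 - \<sigma>\<close>, \<open>\<sigma> = sep M / diameter M\<close>, on every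
  other pair. Hence signed sums of two such functions have Lipschitz norm at most \<open>2 - \<sigma>\<close>, so a
  vector \<open>u\<close> of the free space can satisfy \<open>\<bar>u f\<bar> > (1 - \<sigma>/2) \<parallel>u\<parallel>\<close> for at most one peak
  function \<open>f\<close>.

  Let \<open>T\<close> be an isomorphism onto \<open>\<ell>\<^sub>1\<^sup>n\<close> with \<open>\<parallel>T\<parallel> \<parallel>T\<inverse>\<parallel> (1 - \<sigma>/2) < 1\<close>. Expanding the molecule
  \<open>(\<delta>\<^sub>a - \<delta>\<^sub>b) / d(a,b)\<close>, on which the peak function of \<open>a, b\<close> has the value 1, in the vectors
  \<open>T\<inverse> e\<^sub>i\<close> shows that every peak function is large in this sense on some \<open>T\<inverse> e\<^sub>i\<close>. But there are
  more than \<open>n\<close> pairs of points as soon as \<open>n \<ge> 2\<close>.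
\<close>

subsection \<open>Operators and dual spaces\<close>

lemma sum_fun_apply: "(\<Sum>i\<in>I. g i) y = (\<Sum>i\<in>I. g i y)"
  by (induction I rule: infinite_finite_induct) auto

lemma linear_on_sum:
  assumes V: "subspace V" and T: "linear_on V T" and "finite I" "\<And>i. i \<in> I \<Longrightarrow> u i \<in> V"
  shows "T (\<Sum>i\<in>I. c i *\<^sub>R u i) = (\<Sum>i\<in>I. c i *\<^sub>R T (u i))"
  using assms(3,4)
proof (induction I rule: finite_induct)
  case empty
  have "T (0 *\<^sub>R 0) = 0 *\<^sub>R T 0"
    using T subspace_0[OF V] unfolding linear_on_def by blast
  then show ?case by simp
next
  case (insert i I)
  have "(\<Sum>i\<in>I. c i *\<^sub>R u i) \<in> V"
    by (intro subspace_sum[OF V] subspace_scale[OF V]) (use insert in auto)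
  moreover have "c i *\<^sub>R u i \<in> V"
    using insert by (auto intro: subspace_scale[OF V])
  ultimately show ?case
    using insert T by (simp add: linear_on_def)
qed

text \<open>Real \<open>Sup\<close> bounds its set only if that set is bounded above; this is where
  \<open>bounded_op_on\<close> enters.\<close>

lemma op_norm_on_upper:
  assumes "bounded_op_on V nV nW T" "\<And>v. v \<in> V \<Longrightarrow> 0 \<le> nV v" "v \<in> V" "nV v \<le> 1"
  shows "nW (T v) \<le> op_norm_on V nV nW T"
proof -
  obtain C where C: "\<And>v. v \<in> V \<Longrightarrow> nW (T v) \<le> C * nV v"
    using assms(1) unfolding bounded_op_on_def by auto
  \<comment> \<open>\<open>C\<close> may be negative, so \<open>\<bar>C\<bar>\<close> is the bound
    used on the unit ball.\<close>
  have "nW (T w) \<le> \<bar>C\<bar>" if "w \<in> V" "nV w \<le> 1" for w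
  proof -
    have "C * nV w \<le> \<bar>C\<bar> * nV w"
      by (rule mult_right_mono) (use assms(2) that in auto)
    also have "\<dots> \<le> \<bar>C\<bar>"
      using that by (simp add: mult_left_le)
    finally show ?thesis using C[OF that(1)] by linarith
  qed
  then have "bdd_above {nW (T v) |v. v \<in> V \<and> nV v \<le> 1}"
    by (auto intro!: bdd_aboveI)
  then show ?thesis
    unfolding op_norm_on_def using assms by (auto intro!: cSup_upper)
qed

text \<open>The witness \<open>v0\<close> keeps the set under \<open>Sup\<close> nonempty.\<close>

lemma op_norm_on_least:
  assumes "v0 \<in> V" "nV v0 \<le> 1" "\<And>v. v \<in> V \<Longrightarrow> nV v \<le> 1 \<Longrightarrow> nW (T v) \<le> B"
  shows "op_norm_on V nV nW T \<le> B"
  unfolding op_norm_on_def using assms by (intro cSup_least) auto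

lemma subspace_dual_space: "subspace (dual_space V nV)"
  unfolding subspace_def
proof (intro conjI ballI allI)
  show "0 \<in> dual_space V nV"
    unfolding dual_space_def linear_on_def bounded_op_on_def by (auto intro: exI[of _ 0])
next
  fix \<phi> \<psi> assume a: "\<phi> \<in> dual_space V nV" "\<psi> \<in> dual_space V nV"
  then obtain C D where "\<forall>v\<in>V. \<bar>\<phi> v\<bar> \<le> C * nV v" "\<forall>v\<in>V. \<bar>\<psi> v\<bar> \<le> D * nV v"
    unfolding dual_space_def bounded_op_on_def by blast
  then have "\<bar>(\<phi> + \<psi>) v\<bar> \<le> (C + D) * nV v" if "v \<in> V" for v
    using that abs_triangle_ineq[of "\<phi> v" "\<psi> v"] by (fastforce simp: algebra_simps)
  then have "bounded_op_on V nV abs (\<phi> + \<psi>)"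
    unfolding bounded_op_on_def by blast
  then show "\<phi> + \<psi> \<in> dual_space V nV"
    using a unfolding dual_space_def linear_on_def by (auto simp: algebra_simps)
next
  fix c \<phi> assume a: "\<phi> \<in> dual_space V nV"
  then obtain C where C: "\<And>v. v \<in> V \<Longrightarrow> \<bar>\<phi> v\<bar> \<le> C * nV v"
    unfolding dual_space_def bounded_op_on_def by auto
  have "\<bar>(c *\<^sub>R \<phi>) v\<bar> \<le> (\<bar>c\<bar> * C) * nV v" if "v \<in> V" for v
    using mult_left_mono[OF C[OF that], of "\<bar>c\<bar>"] by (simp add: scaleR_fun_def abs_mult mult.assoc)
  then have "bounded_op_on V nV abs (c *\<^sub>R \<phi>)"
    unfolding bounded_op_on_def by blast
  then show "c *\<^sub>R \<phi> \<in> dual_space V nV"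
    using a unfolding dual_space_def linear_on_def by (auto simp: algebra_simps scaleR_fun_def)
qed

subsection \<open>Lipschitz functions and free spaces\<close>

lemma subspace_Lip0: "subspace (Lip0 M z)"
  unfolding subspace_def
proof (intro conjI ballI allI)
  show "0 \<in> Lip0 M z"
    unfolding Lip0_def by (auto intro!: exI[of _ 0] simp: lipschitz_on_def)
next
  fix f g assume a: "f \<in> Lip0 M z" "g \<in> Lip0 M z"
  then obtain C D where "C-lipschitz_on M f" "D-lipschitz_on M g"
    unfolding Lip0_def by auto
  then have "(C + D)-lipschitz_on M (f + g)"
    unfolding plus_fun_def by (rule lipschitz_on_add)
  then show "f + g \<in> Lip0 M z" using a unfolding Lip0_def by auto
next
  fix c f assume a: "f \<in> Lip0 M z"
  then obtain C where C: "C-lipschitz_on M f"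
    unfolding Lip0_def by auto
  have "(\<bar>c\<bar> * C)-lipschitz_on M (c *\<^sub>R f)"
    unfolding scaleR_fun_def using lipschitz_on_cmult[OF C] by simp
  then show "c *\<^sub>R f \<in> Lip0 M z" using a unfolding Lip0_def by (auto simp: scaleR_fun_def)
qed

lemma slope_le_Lip_norm:
  assumes "f \<in> Lip0 M z" "p \<in> M" "q \<in> M" "p \<noteq> q"
  shows "(f p - f q) / dist p q \<le> Lip_norm M f"
proof -
  obtain L where L: "L-lipschitz_on M f"
    using assms(1) unfolding Lip0_def by auto
  have "(f p - f q) / dist p q \<le> L" if "p \<in> M" "q \<in> M" "p \<noteq> q" for p q
    using lipschitz_onD[OF L that(1,2)] that(3) by (auto simp: dist_real_def field_simps)
  then have "bdd_above {(f p - f q) / dist p q |p q. p \<in> M \<and> q \<in> M \<and> p \<noteq> q}"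
    by (auto intro!: bdd_aboveI)
  then show ?thesis
    unfolding Lip_norm_def using assms by (auto intro!: cSup_upper)
qed

lemma Lip_norm_le:
  assumes "a \<in> M" "b \<in> M" "a \<noteq> b"
    and "\<And>p q. p \<in> M \<Longrightarrow> q \<in> M \<Longrightarrow> p \<noteq> q \<Longrightarrow> f p - f q \<le> B * dist p q"
  shows "Lip_norm M f \<le> B"
  unfolding Lip_norm_def using assms by (intro cSup_least) (auto simp: field_simps)

text \<open>The supremum runs over signed slopes. Swapping the two points flips the sign, so one of
  the two slopes is nonnegative.\<close>

lemma Lip_norm_nonneg:
  assumes "f \<in> Lip0 M z" "a \<in> M" "b \<in> M" "a \<noteq> b"
  shows "0 \<le> Lip_norm M f"
proof -
  have "(f a - f b) / dist a b \<le> Lip_norm M f" "(f b - f a) / dist b a \<le> Lip_norm M f"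
    using assms by (auto intro!: slope_le_Lip_norm)
  moreover have "(f b - f a) / dist b a = - ((f a - f b) / dist a b)"
    by (simp add: dist_commute minus_divide_left)
  ultimately show ?thesis by linarith
qed

lemma abs_diff_le_Lip_norm:
  assumes "f \<in> Lip0 M z" "p \<in> M" "q \<in> M"
  shows "\<bar>f p - f q\<bar> \<le> Lip_norm M f * dist p q"
proof (cases "p = q")
  case False
  then have "(f p - f q) / dist p q \<le> Lip_norm M f" "(f q - f p) / dist q p \<le> Lip_norm M f"
    using assms by (auto intro!: slope_le_Lip_norm)
  then show ?thesis
    using False by (auto simp: field_simps dist_commute)
qed auto

text \<open>Puts the zero function into the unit ball of \<open>Lip0\<close>, as the witness that
  bounds on the dual norm require.\<close>

lemma Lip_norm_zero_le:
  assumes "0 \<le> B" "a \<in> M" "b \<in> M" "a \<noteq> b"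
  shows "Lip_norm M 0 \<le> B"
  by (rule Lip_norm_le[OF assms(2-4)]) (use assms(1) in auto)

section \<open>The dual norm, evaluations, and the free space as a linear subspace\<close>

context
  fixes M :: "'a::metric_space set" and z a b :: 'a
  assumes ab: "a \<in> M" "b \<in> M" "a \<noteq> b"
begin

lemma abs_le_free_norm:
  assumes "\<phi> \<in> dual_space (Lip0 M z) (Lip_norm M)" "f \<in> Lip0 M z" "Lip_norm M f \<le> 1"
  shows "\<bar>\<phi> f\<bar> \<le> free_norm M z \<phi>"
  unfolding free_norm_def dual_norm_def
  by (rule op_norm_on_upper) (use assms Lip_norm_nonneg ab in \<open>auto simp: dual_space_def\<close>)

lemma free_norm_least:
  assumes "\<And>f. f \<in> Lip0 M z \<Longrightarrow> Lip_norm M f \<le> 1 \<Longrightarrow> \<bar>\<phi> f\<bar> \<le> B"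
  shows "free_norm M z \<phi> \<le> B"
  unfolding free_norm_def dual_norm_def
  by (rule op_norm_on_least[of 0])
    (use assms subspace_0[OF subspace_Lip0] Lip_norm_zero_le[OF _ ab] in auto)

lemma free_norm_nonneg:
  assumes "\<phi> \<in> dual_space (Lip0 M z) (Lip_norm M)"
  shows "0 \<le> free_norm M z \<phi>"
  using abs_le_free_norm[OF assms subspace_0[OF subspace_Lip0] Lip_norm_zero_le[OF _ ab]]
  by simp

lemma eval_at_in_dual_space:
  assumes "z \<in> M" "p \<in> M"
  shows "eval_at M z p \<in> dual_space (Lip0 M z) (Lip_norm M)"
proof -
  \<comment> \<open>Since \<open>f z = 0\<close>, the value \<open>f p\<close> is the difference
    \<open>f p - f z\<close>.\<close>
  have "\<bar>eval_at M z p f\<bar> \<le> dist p z * Lip_norm M f" if "f \<in> Lip0 M z" for f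
    using abs_diff_le_Lip_norm[OF that assms(2,1)] that
    by (simp add: eval_at_def Lip0_def mult.commute)
  then have "bounded_op_on (Lip0 M z) (Lip_norm M) abs (eval_at M z p)"
    unfolding bounded_op_on_def by blast
  moreover have "linear_on (Lip0 M z) (eval_at M z p)"
    using subspace_add[OF subspace_Lip0[of M z]] subspace_scale[OF subspace_Lip0[of M z]]
    by (simp add: linear_on_def eval_at_def scaleR_fun_def)
  ultimately show ?thesis
    unfolding dual_space_def by (simp add: eval_at_def)
qed

lemma span_eval_at_subset_dual_space:
  assumes "z \<in> M"
  shows "span (eval_at M z ` M) \<subseteq> dual_space (Lip0 M z) (Lip_norm M)"
  by (rule span_minimal) (use assms eval_at_in_dual_space subspace_dual_space in auto)

lemma span_eval_at_subset_free_space: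
  assumes "z \<in> M"
  shows "span (eval_at M z ` M) \<subseteq> free_space M z"
proof
  fix \<phi> assume \<phi>: "\<phi> \<in> span (eval_at M z ` M)"
  have "free_norm M z (\<phi> - \<phi>) \<le> 0"
    by (rule free_norm_least) auto
  then have "\<forall>e>0. free_norm M z (\<phi> - \<phi>) < e"
    by auto
  then show "\<phi> \<in> free_space M z"
    using \<phi> span_eval_at_subset_dual_space[OF assms] unfolding free_space_def by blast
qed

text \<open>Approximants from the span are added and scaled; the error of the result is estimated at
  each test function of the unit ball.\<close>

lemma subspace_free_space:
  assumes z: "z \<in> M"
  shows "subspace (free_space M z)"
  unfolding subspace_def
proof (intro conjI ballI allI)
  show "0 \<in> free_space M z"
    using span_eval_at_subset_free_space[OF z] span_zero by blast
next
  fix \<phi> \<psi> assume a: "\<phi> \<in> free_space M z" "\<psi> \<in> free_space M z"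
  have d: "\<phi> \<in> dual_space (Lip0 M z) (Lip_norm M)" "\<psi> \<in> dual_space (Lip0 M z) (Lip_norm M)"
    using a unfolding free_space_def by auto
  have "\<exists>\<eta>\<in>span (eval_at M z ` M). free_norm M z (\<phi> + \<psi> - \<eta>) < e" if "e > 0" for e
  proof -
    have "e/2 > 0" using that by simp
    then obtain \<phi>' \<psi>' where s: "\<phi>' \<in> span (eval_at M z ` M)" "\<psi>' \<in> span (eval_at M z ` M)"
      and lt: "free_norm M z (\<phi> - \<phi>') < e/2" "free_norm M z (\<psi> - \<psi>') < e/2"
      using a unfolding free_space_def by blast
    have d': "\<phi> - \<phi>' \<in> dual_space (Lip0 M z) (Lip_norm M)"
      "\<psi> - \<psi>' \<in> dual_space (Lip0 M z) (Lip_norm M)"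
      using s d span_eval_at_subset_dual_space[OF z] subspace_diff[OF subspace_dual_space] by blast+
    have "free_norm M z (\<phi> + \<psi> - (\<phi>' + \<psi>')) \<le> free_norm M z (\<phi> - \<phi>') + free_norm M z (\<psi> - \<psi>')"
    proof (rule free_norm_least)
      fix f assume f: "f \<in> Lip0 M z" "Lip_norm M f \<le> 1"
      show "\<bar>(\<phi> + \<psi> - (\<phi>' + \<psi>')) f\<bar> \<le> free_norm M z (\<phi> - \<phi>') + free_norm M z (\<psi> - \<psi>')"
        using abs_le_free_norm[OF d'(1) f] abs_le_free_norm[OF d'(2) f] by simp
    qed
    then have "free_norm M z (\<phi> + \<psi> - (\<phi>' + \<psi>')) < e" using lt by linarith
    then show ?thesis using span_add[OF s] by blast
  qed
  then show "\<phi> + \<psi> \<in> free_space M z"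
    using subspace_add[OF subspace_dual_space d] unfolding free_space_def by blast
next
  fix c \<phi> assume a: "\<phi> \<in> free_space M z"
  have d: "\<phi> \<in> dual_space (Lip0 M z) (Lip_norm M)"
    using a unfolding free_space_def by auto
  have "\<exists>\<eta>\<in>span (eval_at M z ` M). free_norm M z (c *\<^sub>R \<phi> - \<eta>) < e" if "e > 0" for e
  proof -
    \<comment> \<open>The summand 1 keeps the denominator positive when
      \<open>c = 0\<close>.\<close>
    have "e / (\<bar>c\<bar> + 1) > 0" using that by simp
    then obtain \<phi>' where s: "\<phi>' \<in> span (eval_at M z ` M)"
      and lt: "free_norm M z (\<phi> - \<phi>') < e / (\<bar>c\<bar> + 1)"
      using a unfolding free_space_def by blast
    have d': "\<phi> - \<phi>' \<in> dual_space (Lip0 M z) (Lip_norm M)"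
      using s d span_eval_at_subset_dual_space[OF z] subspace_diff[OF subspace_dual_space] by blast
    have "free_norm M z (c *\<^sub>R \<phi> - c *\<^sub>R \<phi>') \<le> \<bar>c\<bar> * free_norm M z (\<phi> - \<phi>')"
    proof (rule free_norm_least)
      fix f assume f: "f \<in> Lip0 M z" "Lip_norm M f \<le> 1"
      have "(c *\<^sub>R \<phi> - c *\<^sub>R \<phi>') f = c * (\<phi> - \<phi>') f"
        by (simp add: scaleR_fun_def algebra_simps)
      then show "\<bar>(c *\<^sub>R \<phi> - c *\<^sub>R \<phi>') f\<bar> \<le> \<bar>c\<bar> * free_norm M z (\<phi> - \<phi>')"
        using mult_left_mono[OF abs_le_free_norm[OF d' f], of "\<bar>c\<bar>"] by (simp add: abs_mult)
    qed
    also have "\<dots> \<le> (\<bar>c\<bar> + 1) * free_norm M z (\<phi> - \<phi>')"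
      by (rule mult_right_mono) (use free_norm_nonneg[OF d'] in auto)
    also have "\<dots> < e" using lt by (simp add: field_simps)
    finally show ?thesis using span_scale[OF s] by blast
  qed
  then show "c *\<^sub>R \<phi> \<in> free_space M z"
    using subspace_scale[OF subspace_dual_space d] unfolding free_space_def by blast
qed

end

subsection \<open>Molecules and peak functions\<close>

text \<open>On a function in \<open>Lip0 M z\<close> and two distinct points this is the slope
  between them, hence norm at most 1.\<close>

definition molecule :: "'a::metric_space set \<Rightarrow> 'a \<Rightarrow> 'a \<times> 'a \<Rightarrow> ('a \<Rightarrow> real) \<Rightarrow> real" where
  "molecule M z ab =
     inverse (dist (fst ab) (snd ab)) *\<^sub>R (eval_at M z (fst ab) - eval_at M z (snd ab))"

text \<open>The second bracket makes the function vanish at \<open>z\<close>; the value 0 off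
  \<open>M\<close> is the convention of \<open>Lip0\<close>.\<close>

definition peak :: "'a::metric_space set \<Rightarrow> 'a \<Rightarrow> 'a \<times> 'a \<Rightarrow> 'a \<Rightarrow> real" where
  "peak M z ab w = (if w \<in> M then ((dist w (snd ab) - dist w (fst ab)) -
     (dist z (snd ab) - dist z (fst ab))) / 2 else 0)"

lemma molecule_in_free_space:
  assumes "z \<in> M" "fst ab \<in> M" "snd ab \<in> M" "fst ab \<noteq> snd ab"
  shows "molecule M z ab \<in> free_space M z"
proof -
  have "molecule M z ab \<in> span (eval_at M z ` M)"
    unfolding molecule_def using assms by (intro span_scale span_diff span_base) auto
  then show ?thesis
    using span_eval_at_subset_free_space[OF assms(2-4,1)] by blast
qed

lemma free_norm_molecule_le:
  assumes "fst ab \<in> M" "snd ab \<in> M" "fst ab \<noteq> snd ab"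
  shows "free_norm M z (molecule M z ab) \<le> 1"
proof (rule free_norm_least[OF assms])
  fix f assume f: "f \<in> Lip0 M z" "Lip_norm M f \<le> 1"
  have "\<bar>f (fst ab) - f (snd ab)\<bar> \<le> Lip_norm M f * dist (fst ab) (snd ab)"
    using abs_diff_le_Lip_norm f assms by blast
  also have "\<dots> \<le> 1 * dist (fst ab) (snd ab)"
    using f by (intro mult_right_mono) auto
  finally show "\<bar>molecule M z ab f\<bar> \<le> 1"
    using f assms by (simp add: molecule_def scaleR_fun_def eval_at_def abs_mult field_simps)
qed

text \<open>Half the difference of two 1-Lipschitz distance functions; the normalising constant
  cancels.\<close>

lemma peak_diff_le_dist:
  assumes "p \<in> M" "q \<in> M"
  shows "\<bar>peak M z ab p - peak M z ab q\<bar> \<le> dist p q"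
  using assms dist_triangle[of p "fst ab" q] dist_triangle[of q "fst ab" p]
    dist_triangle[of p "snd ab" q] dist_triangle[of q "snd ab" p]
  unfolding peak_def by (simp add: dist_commute abs_le_iff field_simps)

lemma peak_in_Lip0:
  assumes "z \<in> M"
  shows "peak M z ab \<in> Lip0 M z"
proof -
  have "1-lipschitz_on M (peak M z ab)"
  proof (rule lipschitz_onI)
    fix p q assume "p \<in> M" "q \<in> M"
    then show "dist (peak M z ab p) (peak M z ab q) \<le> 1 * dist p q"
      by (simp add: dist_real_def peak_diff_le_dist)
  qed auto
  then show ?thesis using assms unfolding Lip0_def by (auto simp: peak_def)
qed

text \<open>Up to a common constant the peak function is half the distance at the first point and
  minus half the distance at the second.\<close>

lemma molecule_peak:
  assumes "z \<in> M" "fst ab \<in> M" "snd ab \<in> M" "fst ab \<noteq> snd ab"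
  shows "molecule M z ab (peak M z ab) = 1"
  using assms peak_in_Lip0[OF assms(1), of ab]
  by (simp add: molecule_def scaleR_fun_def eval_at_def peak_def dist_commute field_simps)

section \<open>Separation and the slopes of peak functions\<close>

lemma sep_le:
  assumes "p \<in> M" "q \<in> M" "r \<in> M" "p \<noteq> q" "p \<noteq> r" "q \<noteq> r"
  shows "2 * sep M \<le> dist p q + dist p r - dist q r"
proof -
  have "bdd_below {dist x y + dist x z - dist y z | x y z.
      x \<in> M \<and> y \<in> M \<and> z \<in> M \<and> x \<noteq> y \<and> x \<noteq> z \<and> y \<noteq> z}"
  proof (rule bdd_belowI[of _ 0], clarify)
    fix x y z :: 'a
    show "0 \<le> dist x y + dist x z - dist y z"
      using dist_triangle[of y z x] by (simp add: dist_commute)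
  qed
  then have "Inf {dist x y + dist x z - dist y z | x y z.
      x \<in> M \<and> y \<in> M \<and> z \<in> M \<and> x \<noteq> y \<and> x \<noteq> z \<and> y \<noteq> z} \<le> dist p q + dist p r - dist q r"
    using assms by (intro cInf_lower) blast+
  then show ?thesis unfolding sep_def by simp
qed

text \<open>After doubling, the claim involves only distances among \<open>p\<close>,
  \<open>q\<close>, \<open>a\<close>, \<open>b\<close>. If the pairs share a point, it is a
  three-point inequality for \<open>sep\<close>; otherwise the 4-point condition reduces it to such
  inequalities.\<close>

lemma peak_diff_le_sep:
  fixes M :: "'a::metric_space set"
  assumes four_point: "\<And>a b c e. \<lbrakk>a \<in> M; b \<in> M; c \<in> M; e \<in> M\<rbrakk> \<Longrightarrow>
      dist a b + dist c e \<le> max (dist a c + dist b e) (dist b c + dist a e)"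
    and M: "p \<in> M" "q \<in> M" "fst ab \<in> M" "snd ab \<in> M"
    and ne: "p \<noteq> q" "fst ab \<noteq> snd ab" "{p, q} \<noteq> {fst ab, snd ab}"
  shows "peak M z ab p - peak M z ab q \<le> dist p q - sep M"
proof -
  obtain a b where ab: "ab = (a, b)" by (cases ab)
  note M = M[unfolded ab fst_conv snd_conv] and ne = ne[unfolded ab fst_conv snd_conv]
  have "dist p b + dist q a - dist p a - dist q b \<le> 2 * dist p q - 2 * sep M"
  proof (cases "p \<in> {a, b} \<or> q \<in> {a, b}")
    case True
    \<comment> \<open>\<open>c\<close> is the common point of the two pairs and \<open>r\<close> the
      point of \<open>{p, q}\<close> outside \<open>{a, b}\<close>.\<close>
    then obtain c d r where cdr: "{c, d} = {a, b}" "{p, q} = {c, r}" "r \<noteq> a" "r \<noteq> b" "r \<in> M"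
      using ne M by (metis doubleton_eq_iff insert_iff singletonD)
    have "2 * sep M \<le> dist r a + dist r b - dist a b" "2 * sep M \<le> dist a r + dist a b - dist r b"
      "2 * sep M \<le> dist b r + dist b a - dist r a"
      using cdr M ne by (auto intro!: sep_le)
    moreover have "p = a \<and> q = r \<or> p = b \<and> q = r \<or> p = r \<and> q = a \<or> p = r \<and> q = b"
      using cdr by (auto simp: doubleton_eq_iff)
    moreover have "dist r b \<le> dist r a + dist a b" "dist r a \<le> dist r b + dist a b"
      "dist a b \<le> dist r a + dist r b"
      using dist_triangle[of r b a] dist_triangle[of r a b] dist_triangle[of a b r]
      by (auto simp: dist_commute)
    ultimately show ?thesis
      by (elim disjE conjE; simp add: dist_commute)
  next
    case False
    \<comment> \<open>The first two add up to \<open>2 * sep M \<le> dist p q\<close>, which settles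
      the second alternative of the 4-point condition below. The third, with the triangle inequality
      through \<open>p\<close>, settles the first.\<close>
    have "2 * sep M \<le> dist p q + dist p a - dist q a" "2 * sep M \<le> dist p q + dist q a - dist p a"
      "2 * sep M \<le> dist p q + dist q b - dist p b"
      using False M ne sep_le[of p M q a] sep_le[of q M p a] sep_le[of q M p b]
      by (auto simp: dist_commute)
    moreover have "dist a b \<le> dist p a + dist p b"
      using dist_triangle[of a b p] by (simp add: dist_commute)
    moreover have "dist p b + dist q a \<le> dist p q + dist a b \<or>
        dist p b + dist q a \<le> dist q b + dist p a"
      using four_point[of p b q a] M by (simp add: dist_commute le_max_iff_disj)
    ultimately show ?thesis
      using zero_le_dist[of p q] by linarith
  qed
  then show ?thesis using M unfolding peak_def ab by (simp add: field_simps)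
qed

text \<open>No pair of points gives both peak functions full slope, so their signed sums divided by
  \<open>K\<close> lie in the unit ball. Testing \<open>u\<close> on such a sum with the right signs
  gives the bound.\<close>

lemma peak_le_free_norm:
  fixes M :: "'a::metric_space set"
  assumes four_point: "\<And>a b c e. \<lbrakk>a \<in> M; b \<in> M; c \<in> M; e \<in> M\<rbrakk> \<Longrightarrow>
      dist a b + dist c e \<le> max (dist a c + dist b e) (dist b c + dist a e)"
    and "bounded M" "z \<in> M" and u: "u \<in> dual_space (Lip0 M z) (Lip_norm M)"
    and ab: "fst ab \<in> M" "snd ab \<in> M" "fst ab \<noteq> snd ab"
    and cd: "fst cd \<in> M" "snd cd \<in> M" "fst cd \<noteq> snd cd"
    and ne: "{fst ab, snd ab} \<noteq> {fst cd, snd cd}"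
    and sep: "0 \<le> sep M" "sep M \<le> diameter M"
  shows "\<bar>u (peak M z ab)\<bar> + \<bar>u (peak M z cd)\<bar> \<le> (2 - sep M / diameter M) * free_norm M z u"
proof -
  define K where "K = 2 - sep M / diameter M"
  define g where "g s t = (s / K) *\<^sub>R peak M z ab + (t / K) *\<^sub>R peak M z cd" for s t
  have diam: "dist p q \<le> diameter M" if "p \<in> M" "q \<in> M" for p q
    using diameter_bounded_bound[OF \<open>bounded M\<close> that] .
  have diam_pos: "diameter M > 0"
    using diam[OF ab(1,2)] ab(3) zero_less_dist_iff[of "fst ab" "snd ab"] by linarith
  have K: "K \<ge> 1" unfolding K_def using diam_pos sep by simp
  have Lip_g: "Lip_norm M (g s t) \<le> 1" if st: "\<bar>s\<bar> \<le> 1" "\<bar>t\<bar> \<le> 1" for s t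
  proof (rule Lip_norm_le[OF ab])
    fix p q assume pq: "p \<in> M" "q \<in> M" "p \<noteq> q"
    let ?F = "peak M z ab p - peak M z ab q" and ?G = "peak M z cd p - peak M z cd q"
    have small: "\<bar>peak M z e p - peak M z e q\<bar> \<le> dist p q - sep M"
      if "{p, q} \<noteq> {fst e, snd e}" "fst e \<in> M" "snd e \<in> M" "fst e \<noteq> snd e" for e
      using peak_diff_le_sep[of M p q e z, OF four_point] peak_diff_le_sep[of M q p e z, OF four_point]
        that pq by (simp add: dist_commute insert_commute abs_le_iff)
    have "\<bar>?F\<bar> + \<bar>?G\<bar> \<le> 2 * dist p q - sep M"
    \<comment> \<open>\<open>{p, q}\<close> equals at most one of the two pairs, so at least one
      difference gains \<open>sep M\<close>.\<close>
    proof (cases "{p, q} = {fst ab, snd ab}")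
      case True
      then show ?thesis using small[of cd] cd ne peak_diff_le_dist[OF pq(1,2), of z ab] by auto
    next
      case False
      then show ?thesis using small[of ab] ab peak_diff_le_dist[OF pq(1,2), of z cd] by auto
    qed
    \<comment> \<open>The absolute gain \<open>sep M\<close> becomes the relative gain
      \<open>sep M / diameter M\<close> because \<open>dist p q \<le> diameter M\<close>.\<close>
    also have "\<dots> \<le> K * dist p q"
      using mult_right_mono[OF diam[OF pq(1,2)] sep(1)] diam_pos
      by (simp add: K_def field_simps)
    finally have *: "\<bar>?F\<bar> + \<bar>?G\<bar> \<le> K * dist p q" .
    have "s * ?F + t * ?G \<le> \<bar>s\<bar> * \<bar>?F\<bar> + \<bar>t\<bar> * \<bar>?G\<bar>"
      by (metis abs_ge_self abs_mult add_mono)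
    also have "\<dots> \<le> 1 * \<bar>?F\<bar> + 1 * \<bar>?G\<bar>"
      using st by (intro add_mono mult_right_mono) auto
    also have "\<dots> \<le> K * dist p q" using * by simp
    finally have "s * ?F + t * ?G \<le> K * dist p q" .
    moreover have "g s t p - g s t q = (s * ?F + t * ?G) / K"
      by (simp add: g_def scaleR_fun_def diff_divide_distrib add_divide_distrib algebra_simps)
    ultimately show "g s t p - g s t q \<le> 1 * dist p q"
      using K by (simp add: pos_divide_le_eq mult.commute)
  qed
  note Lip0 = peak_in_Lip0[OF \<open>z \<in> M\<close>] subspace_scale[OF subspace_Lip0[of M z]]
    subspace_add[OF subspace_Lip0[of M z]]
  have g: "g s t \<in> Lip0 M z" for s t
    unfolding g_def by (intro Lip0)
  have "u (g s t) = (s * u (peak M z ab) + t * u (peak M z cd)) / K" for s t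
    using u Lip0 unfolding g_def dual_space_def linear_on_def
    by (simp add: add_divide_distrib)
  \<comment> \<open>The signs turn both terms into absolute values.\<close>
  then have "u (g (sgn (u (peak M z ab))) (sgn (u (peak M z cd)))) =
      (\<bar>u (peak M z ab)\<bar> + \<bar>u (peak M z cd)\<bar>) / K"
    by (simp add: linordered_idom_class.abs_sgn mult.commute)
  moreover have "\<bar>u (g (sgn (u (peak M z ab))) (sgn (u (peak M z cd))))\<bar> \<le> free_norm M z u"
    by (rule abs_le_free_norm[OF ab u g Lip_g]) (auto simp: sgn_if)
  ultimately have "(\<bar>u (peak M z ab)\<bar> + \<bar>u (peak M z cd)\<bar>) / K \<le> free_norm M z u"
    by linarith
  then show ?thesis
    using K unfolding K_def[symmetric] by (simp add: pos_divide_le_eq mult.commute)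
qed

subsection \<open>The unit vectors of \<open>\<ell>\<^sub>1\<^sup>n\<close>\<close>

definition unit_vec :: "nat \<Rightarrow> nat \<Rightarrow> real" where
  "unit_vec i = (\<lambda>j. if j = i then 1 else 0)"

lemma unit_vec_in_l1_space: "i < n \<Longrightarrow> unit_vec i \<in> l1_space n"
  by (auto simp: l1_space_def unit_vec_def)

lemma l1_norm_unit_vec: "i < n \<Longrightarrow> l1_norm n (unit_vec i) = 1"
  by (simp add: l1_norm_def unit_vec_def if_distrib[of abs] cong: if_cong)

lemma l1_space_expansion:
  assumes "v \<in> l1_space n"
  shows "v = (\<Sum>i<n. v i *\<^sub>R unit_vec i)"
proof
  fix j
  have "(\<Sum>i<n. v i *\<^sub>R unit_vec i) j = (\<Sum>i<n. if j = i then v i else 0)"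
    unfolding sum_fun_apply by (intro sum.cong) (auto simp: scaleR_fun_def unit_vec_def)
  also have "\<dots> = v j"
    using assms by (simp add: l1_space_def)
  finally show "v j = (\<Sum>i<n. v i *\<^sub>R unit_vec i) j" ..
qed

subsection \<open>The lower bound\<close>

text \<open>There are \<open>n + 1\<close> pairs but only \<open>n\<close> unit vectors, and each
  preimage of a unit vector can be large on at most one peak function. So some peak function is
  small on all preimages, and expanding its molecule in them gives the inequality.\<close>

lemma iso_l1_bound:
  fixes M :: "'a::metric_space set" and n :: nat
  assumes four_point: "\<And>a b c e. \<lbrakk>a \<in> M; b \<in> M; c \<in> M; e \<in> M\<rbrakk> \<Longrightarrow>
      dist a b + dist c e \<le> max (dist a c + dist b e) (dist b c + dist a e)"
    and "bounded M" and z: "z \<in> M"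
    and P: "\<And>k. k \<le> n \<Longrightarrow> fst (P k) \<in> M \<and> snd (P k) \<in> M \<and> fst (P k) \<noteq> snd (P k)"
    and P_inj: "\<And>k l. k \<le> n \<Longrightarrow> l \<le> n \<Longrightarrow> k \<noteq> l \<Longrightarrow> {fst (P k), snd (P k)} \<noteq> {fst (P l), snd (P l)}"
    and sep: "0 \<le> sep M" "sep M \<le> diameter M"
    and iso: "linear_iso (free_space M z) (free_norm M z) (l1_space n) (l1_norm n) T"
  shows "1 \<le> op_norm_on (free_space M z) (free_norm M z) (l1_norm n) T *
             op_norm_on (l1_space n) (l1_norm n) (free_norm M z) (inv_into (free_space M z) T) *
             (1 - sep M / (2 * diameter M))"
proof -
  define V where "V = free_space M z"
  define N where "N = free_norm M z"
  define A where "A = op_norm_on V N (l1_norm n) T"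
  define B where "B = op_norm_on (l1_space n) (l1_norm n) N (inv_into V T)"
  define \<kappa> where "\<kappa> = 1 - sep M / (2 * diameter M)"
  define u where "u i = inv_into V T (unit_vec i)" for i
  define f where "f k = peak M z (P k)" for k
  \<comment> \<open>The pair \<open>P 0\<close> supplies the two distinct points that the free-space
    lemmas ask for.\<close>
  note P0 = P[OF le0]
  have bij: "bij_betw T V (l1_space n)" and lin: "linear_on V T"
    and bdd: "bounded_op_on V N (l1_norm n) T" "bounded_op_on (l1_space n) (l1_norm n) N (inv_into V T)"
    using iso unfolding linear_iso_def V_def N_def by auto
  have V_dual: "V \<subseteq> dual_space (Lip0 M z) (Lip_norm M)"
    unfolding V_def free_space_def by auto
  have V: "subspace V"
    unfolding V_def using P0 z subspace_free_space by blast
  have N_nonneg: "0 \<le> N v" if "v \<in> V" for v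
    using that V_dual P0 free_norm_nonneg unfolding N_def by blast
  have u_V: "u i \<in> V" if "i < n" for i
    using bij_betwE[OF bij_betw_inv_into[OF bij]] unit_vec_in_l1_space[OF that] unfolding u_def by blast
  have T_u: "T (u i) = unit_vec i" if "i < n" for i
    unfolding u_def using bij_betw_inv_into_right[OF bij unit_vec_in_l1_space[OF that]] .
  have N_u: "N (u i) \<le> B" if "i < n" for i
    unfolding u_def B_def
    by (rule op_norm_on_upper[OF bdd(2)])
      (use that in \<open>auto simp: unit_vec_in_l1_space l1_norm_unit_vec\<close>, simp add: l1_norm_def sum_nonneg)
  have \<kappa>: "\<kappa> > 0"
  proof -
    define \<sigma> where "\<sigma> = sep M / diameter M"
    have "\<sigma> \<le> 1"
      \<comment> \<open>For diameter 0 the quotient is 0 by the convention on division.\<close>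
      unfolding \<sigma>_def using sep by (cases "diameter M = 0") (auto simp: divide_le_eq)
    moreover have "\<kappa> = 1 - \<sigma> / 2"
      unfolding \<kappa>_def \<sigma>_def by simp
    ultimately show ?thesis by linarith
  qed
  have "\<exists>k\<le>n. \<forall>i<n. \<bar>u i (f k)\<bar> \<le> B * \<kappa>"
  proof (rule ccontr)
    assume "\<not> ?thesis"
    \<comment> \<open>\<open>h k\<close> picks a coordinate on which the peak function of
      \<open>P k\<close> is large. A collision \<open>h k = h l\<close> contradicts
      \<open>peak_le_free_norm\<close>, since both values exceed \<open>B * \<kappa>\<close> while
      their sum is at most \<open>2 * \<kappa> * B\<close>.\<close>
    then obtain h where h: "\<And>k. k \<le> n \<Longrightarrow> h k < n \<and> B * \<kappa> < \<bar>u (h k) (f k)\<bar>"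
      unfolding not_le by (metis linorder_not_le)
    have "\<not> inj_on h {..n}"
      by (rule pigeonhole) (use h card_mono[of "{..<n}" "h ` {..n}"] in \<open>force\<close>)
    then obtain k l where kl: "k \<le> n" "l \<le> n" "k \<noteq> l" "h k = h l"
      unfolding inj_on_def by auto
    have "u (h k) \<in> V" using u_V h kl(1) by blast
    then have "\<bar>u (h k) (f k)\<bar> + \<bar>u (h k) (f l)\<bar> \<le> (2 - sep M / diameter M) * N (u (h k))"
      unfolding f_def N_def
      using V_dual P[OF kl(1)] P[OF kl(2)] P_inj[OF kl(1-3)]
      by (intro peak_le_free_norm four_point \<open>bounded M\<close> z sep) auto
    also have "\<dots> = 2 * \<kappa> * N (u (h k))" by (simp add: \<kappa>_def)
    also have "\<dots> \<le> 2 * \<kappa> * B"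
      using N_u h kl(1) \<kappa> by simp
    finally show False using h[OF kl(1)] h[OF kl(2)] kl(4) by (simp add: mult.commute)
  qed
  then obtain k where k: "k \<le> n" and small: "\<And>i. i < n \<Longrightarrow> \<bar>u i (f k)\<bar> \<le> B * \<kappa>"
    by blast
  define m where "m = molecule M z (P k)"
  define v where "v = T m"
  have m_V: "m \<in> V"
    unfolding m_def V_def using P[OF k] z by (intro molecule_in_free_space) auto
  have v: "v \<in> l1_space n"
    using bij m_V unfolding v_def by (auto dest: bij_betwE)
  have "T (\<Sum>i<n. v i *\<^sub>R u i) = (\<Sum>i<n. v i *\<^sub>R T (u i))"
    using u_V by (intro linear_on_sum[OF V lin]) auto
  also have "\<dots> = T m"
    using l1_space_expansion[OF v] T_u by (simp add: v_def)
  \<comment> \<open>Both sides lie in \<open>V\<close> and have the same image, so injectivity of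
    \<open>T\<close> on \<open>V\<close> identifies them.\<close>
  finally have "m = (\<Sum>i<n. v i *\<^sub>R u i)"
  proof -
    assume eq: "T (\<Sum>i<n. v i *\<^sub>R u i) = T m"
    have "(\<Sum>i<n. v i *\<^sub>R u i) \<in> V"
      using u_V by (intro subspace_sum[OF V] subspace_scale[OF V]) auto
    then show ?thesis
      using eq m_V bij unfolding bij_betw_def by (metis inj_onD)
  qed
  moreover have "m (f k) = 1"
    unfolding m_def f_def using P[OF k] z by (intro molecule_peak) auto
  ultimately have "1 = (\<Sum>i<n. v i * u i (f k))"
    by (simp add: sum_fun_apply scaleR_fun_def)
  also have "\<dots> \<le> (\<Sum>i<n. \<bar>v i\<bar> * (B * \<kappa>))"
  proof (rule sum_mono)
    fix i assume "i \<in> {..<n}"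
    then have "\<bar>v i\<bar> * \<bar>u i (f k)\<bar> \<le> \<bar>v i\<bar> * (B * \<kappa>)"
      using small by (intro mult_left_mono) auto
    then show "v i * u i (f k) \<le> \<bar>v i\<bar> * (B * \<kappa>)"
      by (metis abs_ge_self abs_mult order_trans)
  qed
  also have "\<dots> = l1_norm n v * (B * \<kappa>)"
    by (simp add: l1_norm_def sum_distrib_right)
  also have "\<dots> \<le> A * (B * \<kappa>)"
  proof (rule mult_right_mono)
    show "l1_norm n v \<le> A"
      unfolding v_def A_def
      using free_norm_molecule_le[of "P k" M z] P[OF k] N_nonneg m_V
      by (intro op_norm_on_upper[OF bdd(1)]) (auto simp: m_def N_def)
    \<comment> \<open>For \<open>n = 0\<close> the chain so far would read \<open>1 \<le> 0\<close>.
      Hence index 0 is available, and \<open>B * \<kappa>\<close> dominates an absolute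
      value.\<close>
    have "n \<noteq> 0"
      using calculation by (cases "n = 0") (auto simp: l1_norm_def)
    then show "0 \<le> B * \<kappa>" using small[of 0] by (meson abs_ge_zero not_gr0 order_trans)
  qed
  finally show ?thesis
    by (simp add: A_def B_def \<kappa>_def V_def N_def mult.assoc)
qed

theorem proposition9:
  fixes T M :: "'a::metric_space set" and x :: "nat \<Rightarrow> 'a" and n :: nat
  assumes "n \<ge> 2"
    and "real_tree T"
    and "M \<subseteq> T"
    and "M = x ` {0..n}"
    and "card M = n + 1"
    and "0 < sep M"
  shows "banach_mazur (free_space M (x 0)) (free_norm M (x 0)) (l1_space n) (l1_norm n)
           > ereal (inverse (1 - sep M / (4 * diameter M)))"
proof -
  \<comment> \<open>Slots 1 to \<open>n\<close> hold the pairs containing \<open>x 0\<close>; slot 0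
    takes one more pair, which exists because \<open>n \<ge> 2\<close>.\<close>
  define P where "P k = (if k = 0 then (x 1, x 2) else (x 0, x k))" for k :: nat
  define \<sigma> where "\<sigma> = sep M / diameter M"
  have inj: "inj_on x {0..n}"
    using assms(4,5) by (intro eq_card_imp_inj_on) auto
  then have x_eq: "x i = x j \<longleftrightarrow> i = j" if "i \<le> n" "j \<le> n" for i j
    using that by (auto simp: inj_on_eq_iff)
  have x_M: "x i \<in> M" if "i \<le> n" for i
    using that assms(4) by auto
  have bounded: "bounded M" using assms(4) by (simp add: finite_imp_bounded)
  have diam: "dist (x 0) (x 1) \<le> diameter M"
    using diameter_bounded_bound[OF bounded] x_M \<open>n \<ge> 2\<close> by simp
  \<comment> \<open>One triple with apex \<open>x 0\<close> and the triangle inequality give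
    \<open>sep M \<le> dist (x 0) (x 1)\<close>.\<close>
  have "2 * sep M \<le> dist (x 0) (x 1) + dist (x 0) (x 2) - dist (x 1) (x 2)"
    using \<open>n \<ge> 2\<close> by (intro sep_le) (auto simp: x_M x_eq)
  also have "\<dots> \<le> 2 * dist (x 0) (x 1)"
    using dist_triangle[of "x 0" "x 2" "x 1"] by linarith
  finally have sep: "sep M \<le> diameter M" using diam by linarith
  have \<sigma>: "0 < \<sigma>" "\<sigma> \<le> 1"
    using sep \<open>0 < sep M\<close> unfolding \<sigma>_def by simp_all
  \<comment> \<open>The bound is uniform over all isomorphisms and so passes to the infimum as a
    weak inequality.\<close>
  have bound: "inverse (1 - \<sigma> / 2) \<le>
      op_norm_on (free_space M (x 0)) (free_norm M (x 0)) (l1_norm n) S *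
      op_norm_on (l1_space n) (l1_norm n) (free_norm M (x 0)) (inv_into (free_space M (x 0)) S)"
    if "linear_iso (free_space M (x 0)) (free_norm M (x 0)) (l1_space n) (l1_norm n) S" for S
  proof -
    have "1 \<le> op_norm_on (free_space M (x 0)) (free_norm M (x 0)) (l1_norm n) S *
        op_norm_on (l1_space n) (l1_norm n) (free_norm M (x 0)) (inv_into (free_space M (x 0)) S) *
        (1 - sep M / (2 * diameter M))"
    proof (rule iso_l1_bound[where P = P, OF _ bounded _ _ _ _ sep that])
      show "dist a b + dist c e \<le> max (dist a c + dist b e) (dist b c + dist a e)"
        if "a \<in> M" "b \<in> M" "c \<in> M" "e \<in> M" for a b c e
        using that assms(2,3) unfolding real_tree_def by blast
      show "fst (P k) \<in> M \<and> snd (P k) \<in> M \<and> fst (P k) \<noteq> snd (P k)" if "k \<le> n" for k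
        using that \<open>n \<ge> 2\<close> by (auto simp: P_def x_M x_eq)
      show "{fst (P k), snd (P k)} \<noteq> {fst (P l), snd (P l)}" if "k \<le> n" "l \<le> n" "k \<noteq> l" for k l
        using that \<open>n \<ge> 2\<close> by (auto simp: P_def x_eq doubleton_eq_iff)
    qed (use x_M \<open>0 < sep M\<close> in auto)
    moreover have "1 - sep M / (2 * diameter M) = 1 - \<sigma> / 2"
      unfolding \<sigma>_def by simp
    ultimately show ?thesis using \<sigma> by (simp add: field_simps)
  qed
  \<comment> \<open>Strictness comes from the gap between \<open>\<sigma> / 4\<close> and
    \<open>\<sigma> / 2\<close>.\<close>
  have "inverse (1 - sep M / (4 * diameter M)) = inverse (1 - \<sigma> / 4)"
    unfolding \<sigma>_def by simp
  also have "\<dots> < inverse (1 - \<sigma> / 2)"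
    using \<sigma> by (intro less_imp_inverse_less) auto
  finally have "ereal (inverse (1 - sep M / (4 * diameter M))) < ereal (inverse (1 - \<sigma> / 2))"
    by simp
  also have "\<dots> \<le> banach_mazur (free_space M (x 0)) (free_norm M (x 0)) (l1_space n) (l1_norm n)"
    unfolding banach_mazur_def by (rule Inf_greatest) (auto dest: bound)
  finally show ?thesis .
qed

end
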